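(* Let $A\in\mathbb{N}_+$ and let $T=(V,E)$ be a tree growing at an exponential rate $A$. For each $v\in V$ let $Z_v$ be a real-valued random variable, all defined on a common probability space $(\Omega,\mathcal{A},\mathbb{P})$, with $\mathbb{E}[Z_v]=0$, $\|Z_v\|_\infty\le C$ and $\mathrm{Var}(Z_v)\le\sigma^2$ for some constants $0<\sigma,C<\infty$ not depending on $v$. Assume that the random field $\{Z_v:v\in V\}$ is strong mixing with respect to the graph metric $d_T$ (i.e. $\alpha_T(n)\to0$ as $n\to\infty$) and that its $\alpha$-mixing coefficients satisfy $$\sum_{k\in\mathbb{N}}\alpha_T(k)\,N(P,k)\in\mathcal{O}\left(P\,A^P\right)\quad (P\to\infty)$$ (for example, the mixing coefficients decay at a super-exponential rate, meaning that there is a positive increasing function $g$ with $\lim_{n\to\infty}g(n)=\infty$ and $\alpha_T(n)\le\exp(-n\,g(n))$). For $L\in\mathbb{N}$ let $$V_L=\{(j,k)\in V:\ 0\le j\le L-1,\ 1\le k\le A^{L-1}\}$$ be the set of nodes of the first $L$ generations of $T$. Then there are constants $c_1,c_2\in\mathbb{R}_+$ such that for all $L\in\mathbb{N}$ with $L\ge2$ and all $\epsilon>0$ $$\mathbb{P}\left(\frac{1}{|V_L|}\left|\sum_{v\in V_L}Z_v\right|>\epsilon\right)\le c_1\exp\left\{-c_2\,\epsilon\,\frac{L}{\log L}\right\}.$$ This means the probability decays asymptotically at a rate which is approximately linear in the size of the sample $V_L$.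
   Context: $\mathbb{N}=\{0,1,2,\ldots\}$, $\mathbb{N}_+=\{1,2,\ldots\}$; $\mathbb{R}_+$ denotes the positive reals; $a\vee b=\max(a,b)$, $a\wedge b=\min(a,b)$; $1_{\{\cdot\}}$ denotes an indicator. Tree growing at an exponential rate $A$ (for $A\in\mathbb{N}_+$): the rooted tree $T=(V,E)$ in which each node has exactly $A$ children, with nodes labeled $V=\{(j,k): j\in\mathbb{N},\,1\le k\le A^j\}$ and edges $E=\{((j,k),(j+1,k')): (j,k)\in V,\ A(k-1)+1\le k'\le Ak\}$, i.e. the root is $(0,1)$ and the children of $(j,k)$ are $(j+1,A(k-1)+1),\ldots,(j+1,Ak)$. Graph metric: $d_T(v,w)$ is the minimal number of edges of a path joining $v$ and $w$ (edges regarded as undirected), and for $I,J\subseteq V$, $d_T(I,J)=\inf\{d_T(v,w):v\in I,w\in J\}$. Mixing coefficient: for $I\subseteq V$ let $\mathcal{F}(I)=\sigma(Z_v:v\in I)$. For $n\in\mathbb{N}$, $$\alpha_T(n)=\sup_{I,J\subseteq V,\ d_T(I,J)\ge n}\ \sup_{A'\in\mathcal{F}(I),\,B'\in\mathcal{F}(J)}|\mathbb{P}(A'\cap B')-\mathbb{P}(A')\mathbb{P}(B')|.$$ Pair counts: for $P\in\mathbb{N}_+$ and $1\le k\le 2(P-1)$, $N(P,k)$ denotes the number of ordered pairs of nodes at distance exactly $k$ in a subtree of $T$ consisting of a node and its descendants, $P$ generations in total; explicitly $$N(P,k)=\sum_{h=0}^{\lfloor P-1-k/2\rfloor}A^h\sum_{i=1\vee(k-(P-1-h))}^{k\wedge(P-1-h)}A^i\left(2\cdot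 1_{\{k=i\}}+(A-1)A^{k-i-1}1_{\{k>i\}}\right).$$ For all other $k\in\mathbb{N}$ set $N(P,k)=0$ (the sums in the formula are then empty).
   Formalization: Proved for A ≥ 2 only: for A = 1 the claim fails (i.i.d. fair signs on the path, ε = (2L)^(-1/2), give probability at least 1/(2L), above the bound for large L). The parenthetical super-exponential example and the closing interpretive sentence are not formalized. *)

theory Defs
  imports "HOL-Probability.Probability" "HOL-Library.Landau_Symbols"
begin

definition tree_nodes :: "nat \<Rightarrow> (nat \<times> nat) set" where
  "tree_nodes A = {(j, k). 1 \<le> k \<and> k \<le> A ^ j}"

definition tree_edges :: "nat \<Rightarrow> ((nat \<times> nat) \<times> (nat \<times> nat)) set" where
  "tree_edges A = {((j, k), (j + 1, k')) | j k k'.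
     (j, k) \<in> tree_nodes A \<and> A * (k - 1) + 1 \<le> k' \<and> k' \<le> A * k}"

definition tree_path :: "nat \<Rightarrow> nat \<times> nat \<Rightarrow> nat \<times> nat \<Rightarrow> (nat \<times> nat) list \<Rightarrow> bool" where
  "tree_path A v w p \<longleftrightarrow>
     p \<noteq> [] \<and> hd p = v \<and> last p = w \<and> distinct p \<and> set p \<subseteq> tree_nodes A \<and>
     successively (\<lambda>x y. (x, y) \<in> tree_edges A \<or> (y, x) \<in> tree_edges A) p"

definition tree_dist :: "nat \<Rightarrow> nat \<times> nat \<Rightarrow> nat \<times> nat \<Rightarrow> enat" where
  "tree_dist A v w = (INF p\<in>{p. tree_path A v w p}. enat (length p - 1))"

text \<open>Since the values are in \<^typ>\<open>enat\<close>, the distance is infinite as soon as one of the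
  sets is empty.\<close>

definition tree_setdist :: "nat \<Rightarrow> (nat \<times> nat) set \<Rightarrow> (nat \<times> nat) set \<Rightarrow> enat" where
  "tree_setdist A I J = (INF v\<in>I. INF w\<in>J. tree_dist A v w)"

definition field_sigma :: "'a measure \<Rightarrow> ('i \<Rightarrow> 'a \<Rightarrow> real) \<Rightarrow> 'i set \<Rightarrow> 'a set set" where
  "field_sigma M Z I =
     sigma_sets (space M) (\<Union>v\<in>I. {Z v -` B \<inter> space M | B. B \<in> sets borel})"

text \<open>On a probability space both suprema are over nonempty sets of reals bounded by 1
  (take \<open>I = J = {}\<close>), so they are proper suprema.\<close>

definition alpha_mixing :: "nat \<Rightarrow> 'a measure \<Rightarrow> (nat \<times> nat \<Rightarrow> 'a \<Rightarrow> real) \<Rightarrow> nat \<Rightarrow> real" where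
  "alpha_mixing A M Z n =
     (SUP (I, J) \<in> {(I, J). I \<subseteq> tree_nodes A \<and> J \<subseteq> tree_nodes A \<and> enat n \<le> tree_setdist A I J}.
        SUP (E, F) \<in> field_sigma M Z I \<times> field_sigma M Z J.
          \<bar>measure M (E \<inter> F) - measure M E * measure M F\<bar>)"

text \<open>The upper limit of \<open>h\<close> is an integer floor and may be negative (empty sum).
  Where the inner sum is reached with \<open>P \<ge> 1\<close>, one has \<open>h \<le> P - 1\<close>, and truncated
  subtraction in \<open>k - (P - 1 - h)\<close> is harmless under the maximum with 1.\<close>

definition pair_count :: "nat \<Rightarrow> nat \<Rightarrow> nat \<Rightarrow> nat" where
  "pair_count A P k =
     (\<Sum>h | int h \<le> \<lfloor>real P - 1 - real k / 2\<rfloor>.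
        A ^ h * (\<Sum>i = max 1 (k - (P - 1 - h))..min k (P - 1 - h).
          A ^ i * (2 * of_bool (k = i) + (A - 1) * A ^ (k - i - 1) * of_bool (k > i))))"

lemma pair_count_eq_0:
  assumes "\<not> (1 \<le> k \<and> k \<le> 2 * (P - 1))"
  shows "pair_count A P k = 0"
proof (cases "k = 0")
  case True
  then show ?thesis by (simp add: pair_count_def)
next
  case False
  with assms have "2 * (P - 1) < k" by auto
  then have "\<not> int h \<le> \<lfloor>real P - 1 - real k / 2\<rfloor>" for h
    by (simp add: le_floor_iff)
  then show ?thesis by (simp add: pair_count_def)
qed

definition first_generations :: "nat \<Rightarrow> nat \<Rightarrow> (nat \<times> nat) set" where
  "first_generations A L = {(j, k) \<in> tree_nodes A. j < L \<and> 1 \<le> k \<and> k \<le> A ^ (L - 1)}"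

end

theory Submission
  imports Defs
begin

text \<open>
  The mean over the first \<open>L\<close> generations has a second moment that decays exponentially in \<open>L\<close>,
  so Chebyshev's inequality is all the concentration that the claimed rate needs. Each generation
  contains about \<open>A\<close> times as many nodes as the previous one, hence \<open>|V\<^sub>L|\<close> is of order \<open>A\<^sup>L\<close>, while a
  ball of radius \<open>n\<close> has at most \<open>(A + 1)\<^sup>n\<close> nodes. With \<open>n\<close> close to \<open>L / 2\<close>, the pairs of nodes at
  distance below \<open>n\<close> are therefore an exponentially small fraction of all pairs. The other pairs
  have covariance at most \<open>4 C\<^sup>2 \<alpha>(n)\<close> (lemma \<open>covariance_le\<close>), and \<open>\<alpha>(n)\<close> is exponentially small
  too: a tree of \<open>m + 1\<close> generations has at least \<open>A\<^sup>2\<^sup>m\<^sup>-\<^sup>1\<close> pairs at the maximal distance \<open>2m\<close>,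
  so this single term of the series in the growth hypothesis already forces
  \<open>\<alpha>(2m) = O(m A\<^sup>-\<^sup>m)\<close> (lemma \<open>alpha_mixing_decay\<close>).

  Adding up covariances bounds the second moment of the mean by a multiple of
  \<open>(3/4)\<^sup>L\<^sup>/\<^sup>4\<close> (lemma \<open>mean_second_moment_decay\<close>) and gives a tail bound
  \<open>K exp (- \<delta> L) / \<epsilon>\<^sup>2\<close> (lemma \<open>mean_tail_decay\<close>). This is stronger than the claim in the only range
  of \<open>\<epsilon>\<close> that matters: for \<open>\<epsilon> \<le> ln L / L\<close> the claimed bound is at least 1, for \<open>\<epsilon> > C\<close> the
  probability is zero, and in between \<open>1 / \<epsilon>\<^sup>2\<close> is at most of order \<open>L\<^sup>2\<close> while
  \<open>\<epsilon> L / ln L\<close> is at most of order \<open>L\<close> (lemma \<open>exponential_bound_from_chebyshev\<close>).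
\<close>

section \<open>A covariance inequality for bounded variables\<close>

text \<open>
  By the layer-cake identity \<open>X + C = \<integral> 1{s < X} ds\<close> over \<open>[-C, C]\<close>, the expectation of \<open>(X + C) g\<close>
  is the integral over \<open>s\<close> of the expectations of \<open>g\<close> on the superlevel sets \<open>{s < X}\<close>; as \<open>g\<close> is centred, the
  shift by \<open>C\<close> costs nothing. The lemma thus replaces a bounded factor by indicators, and it is
  used once for each of the two factors of a covariance.
\<close>

lemma (in prob_space) abs_expectation_mult_le:
  fixes X g :: "'a \<Rightarrow> real"
  assumes X: "X \<in> borel_measurable M" and bd: "AE \<omega> in M. \<bar>X \<omega>\<bar> \<le> C"
    and g: "integrable M g" and g0: "expectation g = 0" and C: "0 \<le> C"
    and le: "\<And>s. \<bar>expectation (\<lambda>\<omega>. indicator {\<omega> \<in> space M. s < X \<omega>} \<omega> * g \<omega>)\<bar> \<le> a"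
  shows "\<bar>expectation (\<lambda>\<omega>. X \<omega> * g \<omega>)\<bar> \<le> 2 * C * a"
proof -
  interpret P: pair_sigma_finite M lborel ..
  define f :: "'a \<Rightarrow> real \<Rightarrow> real"
    where "f \<omega> s = indicator {-C..C} s * (indicator {..<X \<omega>} s * g \<omega>)" for \<omega> s
  have [measurable]: "X \<in> borel_measurable M" "g \<in> borel_measurable M" using X g by auto
  have ind: "indicator {..<X \<omega>} s = (if s < X \<omega> then 1 else 0 :: real)" for \<omega> s by simp
  have meas[measurable]: "case_prod f \<in> borel_measurable (M \<Otimes>\<^sub>M lborel)"
    unfolding f_def ind by measurable
  have intC: "integrable lborel (\<lambda>s. indicator {-C..C} s * c)" for c :: real
    using C by (intro integrable_mult_left) auto
  have inner_int: "integrable lborel (f \<omega>)" if "\<omega> \<in> space M" for \<omega>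
    unfolding f_def
    by (rule Bochner_Integration.integrable_bound[OF intC[of "g \<omega>"]])
       (auto simp: indicator_def)
  have int: "integrable (M \<Otimes>\<^sub>M lborel) (case_prod f)"
  proof (rule P.Fubini_integrable[OF meas])
    show "AE \<omega> in M. integrable lborel (\<lambda>s. case_prod f (\<omega>, s))"
      using inner_int by auto
    have "(\<integral>s. norm (f \<omega> s) \<partial>lborel) \<le> 2 * C * \<bar>g \<omega>\<bar>" if "\<omega> \<in> space M" for \<omega>
    proof -
      have "(\<integral>s. norm (f \<omega> s) \<partial>lborel) \<le> (\<integral>s. indicator {-C..C} s * \<bar>g \<omega>\<bar> \<partial>lborel)"
        using integrable_norm[OF inner_int[OF that]] intC[of "\<bar>g \<omega>\<bar>"]
        by (rule integral_mono) (auto simp: f_def indicator_def)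
      also have "\<dots> = 2 * C * \<bar>g \<omega>\<bar>" using C by simp
      finally show ?thesis .
    qed
    note inner_le = this
    show "integrable M (\<lambda>\<omega>. \<integral>s. norm (case_prod f (\<omega>, s)) \<partial>lborel)"
    proof (rule Bochner_Integration.integrable_bound[where f = "\<lambda>\<omega>. 2 * C * \<bar>g \<omega>\<bar>"])
      show "integrable M (\<lambda>\<omega>. 2 * C * \<bar>g \<omega>\<bar>)" using g by simp
      show "(\<lambda>\<omega>. \<integral>s. norm (case_prod f (\<omega>, s)) \<partial>lborel) \<in> borel_measurable M" by measurable
      show "AE \<omega> in M. norm (\<integral>s. norm (case_prod f (\<omega>, s)) \<partial>lborel) \<le> norm (2 * C * \<bar>g \<omega>\<bar>)"
        using inner_le C by (intro AE_I2) simp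
    qed
  qed
  have layer: "AE \<omega> in M. (\<integral>s. f \<omega> s \<partial>lborel) = (X \<omega> + C) * g \<omega>"
    using bd
  proof eventually_elim
    case (elim \<omega>)
    then have X_range: "- C \<le> X \<omega>" "X \<omega> \<le> C" by linarith+
    have cut: "{-C..C} \<inter> {..<X \<omega>} = {-C..<X \<omega>}" using X_range(2) by auto
    have "f \<omega> s = indicator ({-C..C} \<inter> {..<X \<omega>}) s * g \<omega>" for s
      by (simp only: f_def mult.assoc indicator_inter_arith)
    then have "(\<integral>s. f \<omega> s \<partial>lborel) = (\<integral>s. indicator {-C..<X \<omega>} s * g \<omega> \<partial>lborel)"
      unfolding cut by presburger
    also have "\<dots> = (X \<omega> + C) * g \<omega>" using X_range by simp
    finally show ?case .
  qed
  have intXg: "integrable M (\<lambda>\<omega>. X \<omega> * g \<omega>)"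
  proof (rule Bochner_Integration.integrable_bound[where f = "\<lambda>\<omega>. C * g \<omega>"])
    show "AE \<omega> in M. norm (X \<omega> * g \<omega>) \<le> norm (C * g \<omega>)"
      using bd by eventually_elim (use C in \<open>simp add: abs_mult mult_right_mono\<close>)
  qed (use g in simp_all)
  have "expectation (\<lambda>\<omega>. X \<omega> * g \<omega>) = expectation (\<lambda>\<omega>. (X \<omega> + C) * g \<omega>)"
    using g0 intXg g by (simp add: distrib_right)
  also have "\<dots> = (\<integral>\<omega>. (\<integral>s. f \<omega> s \<partial>lborel) \<partial>M)"
  proof (rule integral_cong_AE)
    show "AE \<omega> in M. (X \<omega> + C) * g \<omega> = (\<integral>s. f \<omega> s \<partial>lborel)"
      using layer by eventually_elim simp
    have "(\<lambda>\<omega>. \<integral>s. case_prod f (\<omega>, s) \<partial>lborel) \<in> borel_measurable M" by measurable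
    then show "(\<lambda>\<omega>. \<integral>s. f \<omega> s \<partial>lborel) \<in> borel_measurable M" by simp
  qed measurable
  also have "\<dots> = (\<integral>s. (\<integral>\<omega>. f \<omega> s \<partial>M) \<partial>lborel)"
    using P.Fubini_integral[OF int] by simp
  finally have eq: "expectation (\<lambda>\<omega>. X \<omega> * g \<omega>) = (\<integral>s. (\<integral>\<omega>. f \<omega> s \<partial>M) \<partial>lborel)" .
  have slice: "\<bar>\<integral>\<omega>. f \<omega> s \<partial>M\<bar> \<le> indicator {-C..C} s * a" for s
  proof -
    have "(\<integral>\<omega>. f \<omega> s \<partial>M) = indicator {-C..C} s *
        expectation (\<lambda>\<omega>. indicator {\<omega> \<in> space M. s < X \<omega>} \<omega> * g \<omega>)"
    proof -
      have "f \<omega> s = indicator {-C..C} s * (indicator {\<omega> \<in> space M. s < X \<omega>} \<omega> * g \<omega>)"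
        if "\<omega> \<in> space M" for \<omega>
        unfolding f_def ind using that by simp
      then have "(\<integral>\<omega>. f \<omega> s \<partial>M) =
          (\<integral>\<omega>. indicator {-C..C} s * (indicator {\<omega> \<in> space M. s < X \<omega>} \<omega> * g \<omega>) \<partial>M)"
        by (intro Bochner_Integration.integral_cong refl)
      then show ?thesis by simp
    qed
    then show ?thesis using le[of s] by (cases "s \<in> {-C..C}") simp_all
  qed
  have "\<bar>\<integral>s. (\<integral>\<omega>. f \<omega> s \<partial>M) \<partial>lborel\<bar> \<le> (\<integral>s. indicator {-C..C} s * a \<partial>lborel)"
    using slice P.integrable_snd[OF int] intC[of a]
    by (intro order_trans[OF integral_abs_bound integral_mono]) auto
  also have "\<dots> = 2 * C * a" using C by simp
  finally show ?thesis using eq by simp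
qed

text \<open>
  The covariance of two indicators is controlled by assumption. First \<open>X\<close> is integrated against
  the centred indicator of \<open>{t < Y}\<close>, then \<open>Y\<close> against the centred \<open>X\<close>; each passage from
  indicators to a variable bounded by \<open>C\<close> contributes a factor \<open>2 C\<close>.
\<close>

lemma (in prob_space) covariance_le:
  fixes X Y :: "'a \<Rightarrow> real"
  assumes X: "X \<in> borel_measurable M" and bX: "AE \<omega> in M. \<bar>X \<omega>\<bar> \<le> C"
    and Y: "Y \<in> borel_measurable M" and bY: "AE \<omega> in M. \<bar>Y \<omega>\<bar> \<le> C" and C: "0 \<le> C"
    and dep: "\<And>s t. \<bar>prob ({\<omega> \<in> space M. s < X \<omega>} \<inter> {\<omega> \<in> space M. t < Y \<omega>})
       - prob {\<omega> \<in> space M. s < X \<omega>} * prob {\<omega> \<in> space M. t < Y \<omega>}\<bar> \<le> a"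
  shows "\<bar>expectation (\<lambda>\<omega>. X \<omega> * Y \<omega>) - expectation X * expectation Y\<bar> \<le> 4 * C\<^sup>2 * a"
proof -
  have [measurable]: "X \<in> borel_measurable M" "Y \<in> borel_measurable M" using X Y by auto
  have iX: "integrable M X" and iY: "integrable M Y"
    using bX bY by (auto intro!: integrable_const_bound[where B = C])
  have iXY: "integrable M (\<lambda>\<omega>. X \<omega> * Y \<omega>)"
  proof (rule integrable_const_bound[where B = "C * C"])
    show "AE \<omega> in M. norm (X \<omega> * Y \<omega>) \<le> C * C"
      using bX bY by eventually_elim (use C in \<open>auto simp: abs_mult intro!: mult_mono\<close>)
  qed simp
  have X_against_indicator: "\<bar>expectation (\<lambda>\<omega>. X \<omega> * (indicator {\<omega> \<in> space M. t < Y \<omega>} \<omega>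
      - prob {\<omega> \<in> space M. t < Y \<omega>}))\<bar> \<le> 2 * C * a" for t
  proof (rule abs_expectation_mult_le[OF X bX _ _ C])
    let ?F = "{\<omega> \<in> space M. t < Y \<omega>}"
    have F[measurable]: "?F \<in> sets M" by measurable
    show "integrable M (\<lambda>\<omega>. indicator ?F \<omega> - prob ?F)"
      using F by (intro Bochner_Integration.integrable_diff integrable_real_indicator) (auto simp: emeasure_eq_measure)
    show "expectation (\<lambda>\<omega>. indicator ?F \<omega> - prob ?F) = 0"
      using F by (subst Bochner_Integration.integral_diff) (auto simp: prob_space emeasure_eq_measure)
    show "\<bar>expectation (\<lambda>\<omega>. indicator {\<omega> \<in> space M. s < X \<omega>} \<omega>
        * (indicator ?F \<omega> - prob ?F))\<bar> \<le> a" for s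
    proof -
      let ?E = "{\<omega> \<in> space M. s < X \<omega>}"
      have E[measurable]: "?E \<in> sets M" by measurable
      have "expectation (\<lambda>\<omega>. indicator ?E \<omega> * (indicator ?F \<omega> - prob ?F))
        = expectation (\<lambda>\<omega>. indicator (?E \<inter> ?F) \<omega> - indicator ?E \<omega> * prob ?F)"
        by (intro Bochner_Integration.integral_cong) (auto simp: indicator_def)
      also have "\<dots> = prob (?E \<inter> ?F) - prob ?E * prob ?F"
        using sets.Int[OF E F] E
        by (subst Bochner_Integration.integral_diff)
           (auto simp: emeasure_eq_measure intro!: integrable_real_indicator integrable_mult_left)
      finally show ?thesis using dep[of s t] by simp
    qed
  qed
  have "\<bar>expectation (\<lambda>\<omega>. Y \<omega> * (X \<omega> - expectation X))\<bar> \<le> 2 * C * (2 * C * a)"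
  proof (rule abs_expectation_mult_le[OF Y bY _ _ C])
    show "integrable M (\<lambda>\<omega>. X \<omega> - expectation X)" using iX by simp
    show "expectation (\<lambda>\<omega>. X \<omega> - expectation X) = 0" using iX by (simp add: prob_space)
    show "\<bar>expectation (\<lambda>\<omega>. indicator {\<omega> \<in> space M. t < Y \<omega>} \<omega> * (X \<omega> - expectation X))\<bar>
        \<le> 2 * C * a" for t
    proof -
      let ?F = "{\<omega> \<in> space M. t < Y \<omega>}"
      have F[measurable]: "?F \<in> sets M" by measurable
      have iXF: "integrable M (\<lambda>\<omega>. X \<omega> * indicator ?F \<omega>)"
        using iX F by (rule integrable_real_mult_indicator[rotated])
      have "expectation (\<lambda>\<omega>. indicator ?F \<omega> * (X \<omega> - expectation X))
        = expectation (\<lambda>\<omega>. X \<omega> * indicator ?F \<omega> - indicator ?F \<omega> * expectation X)"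
        by (simp add: algebra_simps)
      also have "\<dots> = expectation (\<lambda>\<omega>. X \<omega> * indicator ?F \<omega>) - prob ?F * expectation X"
        using iXF F by (subst Bochner_Integration.integral_diff) (auto simp: emeasure_eq_measure)
      also have "\<dots> = expectation (\<lambda>\<omega>. X \<omega> * indicator ?F \<omega> - X \<omega> * prob ?F)"
        using iXF iX by (subst Bochner_Integration.integral_diff) auto
      also have "\<dots> = expectation (\<lambda>\<omega>. X \<omega> * (indicator ?F \<omega> - prob ?F))"
        by (simp add: right_diff_distrib)
      finally show ?thesis using X_against_indicator[of t] by simp
    qed
  qed
  moreover have "expectation (\<lambda>\<omega>. Y \<omega> * (X \<omega> - expectation X))
      = expectation (\<lambda>\<omega>. X \<omega> * Y \<omega> - Y \<omega> * expectation X)"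
    by (simp add: algebra_simps)
  ultimately show ?thesis using iXY iY by (simp add: power2_eq_square algebra_simps)
qed

section \<open>Distances and sizes in the tree\<close>

definition adj :: "nat \<Rightarrow> (nat \<times> nat) rel" where
  "adj A = tree_edges A \<union> (tree_edges A)\<inverse>"

lemma adj_card: assumes "1 \<le> A" shows "finite (adj A `` {v}) \<and> card (adj A `` {v}) \<le> A + 1"
proof -
  obtain j k where v: "v = (j, k)" by fastforce
  let ?C = "Pair (j + 1) ` {A * (k - 1) + 1..A * k}" and ?U = "{(j - 1, (k - 1) div A + 1)}"
  \<comment> \<open>The parent of the node \<open>k\<close> of a generation is the node \<open>(k - 1) div A + 1\<close> of the one above.\<close>
  have par: "i = (k - 1) div A + 1" if "A * (i - 1) + 1 \<le> k" "k \<le> A * i" "1 \<le> i" for i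
  proof -
    have "(k - 1) div A = i - 1"
      using that assms by (intro div_nat_eqI) (auto simp: algebra_simps)
    then show ?thesis using that by simp
  qed
  have sub: "adj A `` {v} \<subseteq> ?C \<union> ?U"
    using par by (auto simp: adj_def tree_edges_def tree_nodes_def v)
  have "card (?C \<union> ?U) \<le> card ?C + card ?U" by (rule card_Un_le)
  also have "card ?C \<le> A" by (rule order_trans[OF card_image_le]) (auto simp: algebra_simps diff_mult_distrib2)
  finally have "card (?C \<union> ?U) \<le> A + 1" by simp
  moreover have "finite (?C \<union> ?U)" by simp
  ultimately show ?thesis using sub card_mono finite_subset by (metis (no_types, lifting) order_trans)
qed

lemma relpow_card:
  fixes R :: "'b rel"
  assumes "\<And>x. finite (R `` {x}) \<and> card (R `` {x}) \<le> d"
  shows "finite ((R ^^ n) `` {v}) \<and> card ((R ^^ n) `` {v}) \<le> d ^ n"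
proof (induction n)
  case (Suc n)
  have eq: "(R ^^ Suc n) `` {v} = (\<Union>x\<in>(R ^^ n) `` {v}. R `` {x})" by auto
  have "card (\<Union>x\<in>(R ^^ n) `` {v}. R `` {x}) \<le> (\<Sum>x\<in>(R ^^ n) `` {v}. card (R `` {x}))"
    using Suc by (intro card_UN_le) auto
  also have "\<dots> \<le> (\<Sum>x\<in>(R ^^ n) `` {v}. d)" using assms by (intro sum_mono) auto
  also have "\<dots> \<le> d ^ Suc n" using Suc by simp
  finally show ?case unfolding eq using Suc assms by auto
qed simp

lemma successively_relpow:
  "p \<noteq> [] \<Longrightarrow> successively (\<lambda>x y. (x, y) \<in> R) p \<Longrightarrow> (hd p, last p) \<in> R ^^ (length p - 1)"
proof (induction p rule: induct_list012)
  case (3 x y zs)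
  then have "(x, y) \<in> R" "(y, last (y # zs)) \<in> R ^^ length zs" by auto
  then have "(x, last (y # zs)) \<in> R ^^ Suc (length zs)" by (rule relpow_Suc_I2)
  then show ?case by simp
qed auto

text \<open>
  Degrees are at most \<open>A + 1\<close>. A node at distance \<open>l\<close> is the end of a walk with \<open>l\<close> steps,
  and there are at most \<open>(A + 1)\<^sup>l\<close> such walks. The radius is strict so that the geometric sum over
  \<open>l < n\<close> stays below \<open>(A + 1)\<^sup>n\<close>.
\<close>

lemma ball_card:
  assumes A: "1 \<le> A"
  shows "finite {w. tree_dist A v w < enat n} \<and> card {w. tree_dist A v w < enat n} \<le> (A + 1) ^ n"
proof -
  let ?B = "\<Union>l<n. (adj A ^^ l) `` {v}"
  have step: "finite ((adj A ^^ l) `` {v})" "card ((adj A ^^ l) `` {v}) \<le> (A + 1) ^ l" for l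
    using relpow_card[of "adj A" "A + 1" l v] adj_card[OF A] by auto
  have "{w. tree_dist A v w < enat n} \<subseteq> ?B"
  proof
    fix w assume "w \<in> {w. tree_dist A v w < enat n}"
    then obtain p where p: "tree_path A v w p" "length p - 1 < n"
      by (auto simp: tree_dist_def INF_less_iff)
    have "(hd p, last p) \<in> adj A ^^ (length p - 1)"
      using p(1) by (intro successively_relpow) (auto simp: tree_path_def adj_def)
    then show "w \<in> ?B" using p by (auto simp: tree_path_def)
  qed
  moreover have "finite ?B" using step by auto
  moreover have "card ?B \<le> (A + 1) ^ n"
  proof -
    have "card ?B \<le> (\<Sum>l<n. (A + 1) ^ l)"
      using step by (intro order_trans[OF card_UN_le] sum_mono) auto
    also have "\<dots> \<le> (A + 1) ^ n"
    proof (induction n)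
      case (Suc n)
      have "(A + 1) ^ n + (A + 1) ^ n \<le> (A + 1) ^ Suc n"
        using mult_right_mono[of 2 "A + 1" "(A + 1) ^ n"] A by (simp add: mult_2)
      then show ?case using Suc unfolding sum.lessThan_Suc by linarith
    qed simp
    finally show ?thesis .
  qed
  ultimately show ?thesis
    using finite_subset[of "{w. tree_dist A v w < enat n}" ?B]
      card_mono[of ?B "{w. tree_dist A v w < enat n}"] by simp
qed

lemma first_generations_finite: "finite (first_generations A L)"
  by (rule finite_subset[of _ "{..<L} \<times> {..A ^ (L - 1)}"]) (auto simp: first_generations_def)

lemma first_generations_card:
  assumes "1 \<le> L" shows "A ^ (L - 1) \<le> card (first_generations A L)"
proof -
  have "card (Pair (L - 1) ` {1..A ^ (L - 1)}) \<le> card (first_generations A L)"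
    using assms
    by (intro card_mono first_generations_finite) (auto simp: first_generations_def tree_nodes_def)
  then show ?thesis by (simp add: card_image inj_on_def)
qed

section \<open>Decay of the mixing coefficients\<close>

lemma (in prob_space) dependence_le_1: "\<bar>prob (E \<inter> F) - prob E * prob F\<bar> \<le> 1"
proof -
  have "0 \<le> prob E * prob F" "prob E * prob F \<le> 1" "0 \<le> prob (E \<inter> F)" "prob (E \<inter> F) \<le> 1"
    by (auto intro: mult_le_one)
  then show ?thesis by linarith
qed

text \<open>
  A supremum of reals bounds its members only if the set is bounded above; here all values of both
  nested suprema are at most 1.
\<close>

lemma (in prob_space) dependence_le_alpha_mixing:
  assumes "I \<subseteq> tree_nodes A" "J \<subseteq> tree_nodes A" "enat n \<le> tree_setdist A I J"
    and "E \<in> field_sigma M Z I" "F \<in> field_sigma M Z J"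
  shows "\<bar>prob (E \<inter> F) - prob E * prob F\<bar> \<le> alpha_mixing A M Z n"
proof -
  have ne: "field_sigma M Z K \<noteq> {}" for K
    unfolding field_sigma_def using sigma_sets.Empty by blast
  let ?f = "\<lambda>(E, F). \<bar>prob (E \<inter> F) - prob E * prob F\<bar>"
  have bdd: "bdd_above (?f ` S)" for S by (rule bdd_aboveI[of _ 1]) (use dependence_le_1 in auto)
  have "?f (E, F) \<le> (SUP x \<in> field_sigma M Z I \<times> field_sigma M Z J. ?f x)"
    using assms by (intro cSUP_upper bdd) auto
  also have "\<dots> \<le> alpha_mixing A M Z n"
  proof -
    let ?g = "\<lambda>(I, J). SUP x \<in> field_sigma M Z I \<times> field_sigma M Z J. ?f x"
    have g1: "?g IJ \<le> 1" for IJ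
      using ne dependence_le_1 by (cases IJ) (auto intro!: cSUP_least)
    have "?g (I, J) \<le> (SUP x \<in> {(I, J). I \<subseteq> tree_nodes A \<and> J \<subseteq> tree_nodes A \<and> enat n \<le> tree_setdist A I J}. ?g x)"
      using assms g1 by (intro cSUP_upper bdd_aboveI[of _ 1]) auto
    then show ?thesis by (simp add: alpha_mixing_def)
  qed
  finally show ?thesis by simp
qed

lemma (in prob_space) alpha_mixing_bounds:
  "0 \<le> alpha_mixing A M Z n" "alpha_mixing A M Z n \<le> 1"
proof -
  have em: "{} \<in> field_sigma M Z K" for K
    unfolding field_sigma_def by (rule sigma_sets.Empty)
  have "\<bar>prob ({} \<inter> {}) - prob {} * prob {}\<bar> \<le> alpha_mixing A M Z n"
    by (rule dependence_le_alpha_mixing[of "{}" A "{}"]) (auto simp: em tree_setdist_def)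
  then show "0 \<le> alpha_mixing A M Z n" by simp
  show "alpha_mixing A M Z n \<le> 1"
    unfolding alpha_mixing_def
  proof (rule cSUP_least)
    show "{(I, J). I \<subseteq> tree_nodes A \<and> J \<subseteq> tree_nodes A \<and> enat n \<le> tree_setdist A I J} \<noteq> {}"
      by (auto intro!: exI[of _ "{}"] simp: tree_setdist_def)
  next
    have ne: "field_sigma M Z K \<noteq> {}" for K using em by blast
    fix x
    show "(case x of (I, J) \<Rightarrow> SUP (E, F)\<in>field_sigma M Z I \<times> field_sigma M Z J.
        \<bar>prob (E \<inter> F) - prob E * prob F\<bar>) \<le> 1"
      using ne dependence_le_1 by (cases x) (auto intro!: cSUP_least)
  qed
qed

text \<open>
  At the diameter \<open>2 m\<close> of a tree with \<open>m + 1\<close> generations the double sum has one term, \<open>h = 0\<close> and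
  \<open>i = m\<close>: such pairs are two leaves whose paths to the root meet only there.
\<close>

lemma pair_count_extreme:
  assumes "1 \<le> m" shows "pair_count A (m + 1) (2 * m) = (A - 1) * A ^ (2 * m - 1)"
proof -
  have "{h :: nat. int h \<le> \<lfloor>real (m + 1) - 1 - real (2 * m) / 2\<rfloor>} = {0}" by auto
  moreover have "max 1 (2 * m - m) = m" "min (2 * m) m = m" using assms by auto
  moreover have "A ^ m * A ^ (m - 1) = A ^ (2 * m - 1)"
    using assms by (simp add: power_add[symmetric] mult_2)
  ultimately show ?thesis using assms by (simp add: pair_count_def mult.left_commute)
qed

text \<open>
  All terms of the series are nonnegative, so for \<open>P = m + 1\<close> the term \<open>k = 2 m\<close> alone obeys the bound
  \<open>c P A\<^sup>P\<close>; its pair count exceeds \<open>A\<^sup>P\<close> by a factor of order \<open>A\<^sup>m\<close>. The asymptotic hypothesis says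
  nothing about small \<open>m\<close>, where \<open>\<alpha> \<le> 1\<close> is absorbed in the second summand of the constant \<open>K\<close>.
\<close>

lemma (in prob_space) alpha_mixing_decay:
  assumes A: "2 \<le> A"
    and rate: "(\<lambda>P. \<Sum>k. alpha_mixing A M Z k * real (pair_count A P k))
                 \<in> O(\<lambda>P. real P * real A ^ P)"
  shows "\<exists>K>0. \<forall>m. alpha_mixing A M Z (2 * m) \<le> K * (real m + 1) / real A ^ m"
proof -
  let ?\<alpha> = "alpha_mixing A M Z"
  obtain c where c: "0 < c" and ev: "\<forall>\<^sub>F P in at_top.
      norm (\<Sum>k. ?\<alpha> k * real (pair_count A P k)) \<le> c * norm (real P * real A ^ P)"
    using rate by (auto elim: landau_o.bigE)
  then obtain N where N: "\<And>P. N \<le> P \<Longrightarrow>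
      \<bar>\<Sum>k. ?\<alpha> k * real (pair_count A P k)\<bar> \<le> c * (real P * real A ^ P)"
    by (auto simp: eventually_at_top_linorder)
  define K where "K = c * real A ^ 2 + real A ^ (N + 1)"
  have A1: "1 \<le> real A" using A by simp
  have "?\<alpha> (2 * m) \<le> K * (real m + 1) / real A ^ m" for m
  proof (cases "m < N + 1")
    case True
    have "?\<alpha> (2 * m) \<le> 1" by (rule alpha_mixing_bounds)
    also have "real A ^ m \<le> real A ^ (N + 1) * (real m + 1)"
      using mult_mono[of "real A ^ m" "real A ^ (N + 1)" 1 "real m + 1"]
        power_increasing[of m "N + 1" "real A"] True A1 by simp
    then have "1 \<le> real A ^ (N + 1) * (real m + 1) / real A ^ m" using A1 by (simp add: field_simps)
    also have "\<dots> \<le> K * (real m + 1) / real A ^ m"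
      unfolding K_def using c by (intro divide_right_mono mult_right_mono) auto
    finally show ?thesis .
  next
    case False
    then have m: "1 \<le> m" "N \<le> m + 1" by auto
    let ?f = "\<lambda>k. ?\<alpha> k * real (pair_count A (m + 1) k)"
    have "real A ^ (2 * m - 1) \<le> real (pair_count A (m + 1) (2 * m))"
      using A A1 mult_right_mono[of 1 "real A - 1" "real A ^ (2 * m - 1)"]
      unfolding pair_count_extreme[OF m(1)] by (simp add: of_nat_diff)
    then have "?\<alpha> (2 * m) * real A ^ (2 * m - 1) \<le> ?f (2 * m)"
      by (intro mult_left_mono alpha_mixing_bounds)
    also have "\<dots> \<le> sum ?f {..2 * m}"
      by (rule member_le_sum) (auto intro!: mult_nonneg_nonneg alpha_mixing_bounds)
    also have "\<dots> = (\<Sum>k. ?f k)"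
      by (rule suminf_finite[symmetric]) (auto intro!: pair_count_eq_0)
    also have "\<dots> \<le> c * (real (m + 1) * real A ^ (m + 1))" using N[OF m(2)] by linarith
    finally have *: "?\<alpha> (2 * m) * real A ^ (2 * m - 1) \<le> c * (real (m + 1) * real A ^ (m + 1))" .
    have e: "real A ^ (2 * m - 1) * real A = real A ^ m * real A ^ m"
      using m(1) by (simp add: power_add[symmetric] mult_2[symmetric] power_Suc2[symmetric] del: power_Suc)
    have "?\<alpha> (2 * m) * real A ^ m * real A ^ m \<le> c * real A ^ 2 * (real m + 1) * real A ^ m"
    proof -
      have "?\<alpha> (2 * m) * real A ^ m * real A ^ m = ?\<alpha> (2 * m) * real A ^ (2 * m - 1) * real A"
        using e by (simp only: mult.assoc)
      also have "\<dots> \<le> c * (real (m + 1) * real A ^ (m + 1)) * real A"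
        using * A1 by (intro mult_right_mono) auto
      finally show ?thesis by (simp add: power2_eq_square algebra_simps)
    qed
    then have "?\<alpha> (2 * m) * real A ^ m \<le> c * real A ^ 2 * (real m + 1)"
      using A1 by (simp add: mult_le_cancel_right)
    also have "\<dots> \<le> K * (real m + 1)" unfolding K_def by (intro mult_right_mono) auto
    finally show ?thesis using A1 by (simp add: field_simps)
  qed
  moreover have "0 < K" using c A1 by (simp add: K_def add_pos_pos)
  ultimately show ?thesis by blast
qed

section \<open>Second moment of the mean\<close>

locale tree_field = prob_space M
  for M :: "'a measure" +
  fixes A :: nat and Z :: "nat \<times> nat \<Rightarrow> 'a \<Rightarrow> real" and C :: real
  assumes A: "2 \<le> A" and C: "0 < C"
    and meas: "v \<in> tree_nodes A \<Longrightarrow> Z v \<in> borel_measurable M"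
    and mean: "v \<in> tree_nodes A \<Longrightarrow> expectation (Z v) = 0"
    and bound: "v \<in> tree_nodes A \<Longrightarrow> AE \<omega> in M. \<bar>Z v \<omega>\<bar> \<le> C"
begin

lemma level_set_in_field_sigma: "{\<omega> \<in> space M. s < Z v \<omega>} \<in> field_sigma M Z {v}"
proof -
  have "Z v -` {s<..} \<inter> space M \<in> field_sigma M Z {v}"
    unfolding field_sigma_def by (intro sigma_sets.Basic) (auto intro!: exI[of _ "{s<..}"])
  moreover have "Z v -` {s<..} \<inter> space M = {\<omega> \<in> space M. s < Z v \<omega>}" by auto
  ultimately show ?thesis by simp
qed

lemma abs_product_le:
  assumes "v \<in> tree_nodes A" "w \<in> tree_nodes A"
  shows "AE \<omega> in M. \<bar>Z v \<omega> * Z w \<omega>\<bar> \<le> C\<^sup>2"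
  using bound[OF assms(1)] bound[OF assms(2)]
  by eventually_elim (use C in \<open>auto simp: abs_mult power2_eq_square intro!: mult_mono\<close>)

lemma product_integrable:
  assumes "v \<in> tree_nodes A" "w \<in> tree_nodes A"
  shows "integrable M (\<lambda>\<omega>. Z v \<omega> * Z w \<omega>)"
  using abs_product_le[OF assms] meas[OF assms(1)] meas[OF assms(2)]
  by (intro integrable_const_bound[where B = "C\<^sup>2"]) auto

text \<open>
  Both summands on the right are nonnegative, so one inequality covers close pairs (trivial bound
  \<open>C\<^sup>2\<close>) and distant pairs (mixing), and can be summed over all pairs without splitting the sum.
\<close>

lemma product_expectation_le:
  assumes v: "v \<in> tree_nodes A" and w: "w \<in> tree_nodes A"
  shows "expectation (\<lambda>\<omega>. Z v \<omega> * Z w \<omega>) \<le>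
    C\<^sup>2 * of_bool (tree_dist A v w < enat n) + 4 * C\<^sup>2 * alpha_mixing A M Z n"
proof (cases "tree_dist A v w < enat n")
  case True
  have "expectation (\<lambda>\<omega>. Z v \<omega> * Z w \<omega>) \<le> expectation (\<lambda>\<omega>. C\<^sup>2)"
    using abs_product_le[OF v w] product_integrable[OF v w]
    by (intro integral_mono_AE) (auto elim: eventually_mono)
  then show ?thesis using True alpha_mixing_bounds(1)[of A Z n] by (simp add: prob_space add_increasing2)
next
  case False
  then have "enat n \<le> tree_setdist A {v} {w}" by (simp add: tree_setdist_def)
  then have "\<bar>expectation (\<lambda>\<omega>. Z v \<omega> * Z w \<omega>) - expectation (Z v) * expectation (Z w)\<bar>
      \<le> 4 * C\<^sup>2 * alpha_mixing A M Z n"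
    using v w C
    by (intro covariance_le meas bound dependence_le_alpha_mixing[of "{v}" A "{w}"]
        level_set_in_field_sigma) auto
  then show ?thesis using False mean[OF v] by simp
qed

text \<open>
  In the expansion of the square, each row \<open>v\<close> has at most \<open>(A + 1)\<^sup>n\<close> close partners \<open>w\<close>.
\<close>

lemma sum_second_moment_le:
  assumes W: "finite W" "W \<subseteq> tree_nodes A"
  shows "integrable M (\<lambda>\<omega>. (\<Sum>v\<in>W. Z v \<omega>)\<^sup>2)"
    and "expectation (\<lambda>\<omega>. (\<Sum>v\<in>W. Z v \<omega>)\<^sup>2) \<le>
      C\<^sup>2 * real (card W) * real (A + 1) ^ n + 4 * C\<^sup>2 * alpha_mixing A M Z n * (real (card W))\<^sup>2"
proof -
  have sq: "(\<Sum>v\<in>W. Z v \<omega>)\<^sup>2 = (\<Sum>v\<in>W. \<Sum>w\<in>W. Z v \<omega> * Z w \<omega>)" for \<omega>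
    by (simp add: power2_eq_square sum_product)
  have int: "integrable M (\<lambda>\<omega>. Z v \<omega> * Z w \<omega>)" if "v \<in> W" "w \<in> W" for v w
    using that W by (intro product_integrable) auto
  then show "integrable M (\<lambda>\<omega>. (\<Sum>v\<in>W. Z v \<omega>)\<^sup>2)"
    unfolding sq by auto
  let ?\<alpha> = "alpha_mixing A M Z n"
  have row: "(\<Sum>w\<in>W. C\<^sup>2 * of_bool (tree_dist A v w < enat n) + 4 * C\<^sup>2 * ?\<alpha>)
      \<le> C\<^sup>2 * real (A + 1) ^ n + 4 * C\<^sup>2 * ?\<alpha> * real (card W)" for v
  proof -
    let ?B = "{w. tree_dist A v w < enat n}"
    have B: "finite ?B" "card ?B \<le> (A + 1) ^ n" using ball_card[of A v n] A by auto
    have "(\<Sum>w\<in>W. of_bool (tree_dist A v w < enat n)) = real (card (W \<inter> ?B))"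
      using W(1) by (simp add: of_bool_def sum.If_cases)
    also have "\<dots> \<le> real ((A + 1) ^ n)"
      using B card_mono[OF B(1), of "W \<inter> ?B"] by (intro of_nat_mono) auto
    finally have "C\<^sup>2 * (\<Sum>w\<in>W. of_bool (tree_dist A v w < enat n)) \<le> C\<^sup>2 * real (A + 1) ^ n"
      by (intro mult_left_mono) auto
    then show ?thesis by (simp add: sum.distrib sum_distrib_left mult.commute)
  qed
  have "expectation (\<lambda>\<omega>. (\<Sum>v\<in>W. Z v \<omega>)\<^sup>2)
      = (\<Sum>v\<in>W. \<Sum>w\<in>W. expectation (\<lambda>\<omega>. Z v \<omega> * Z w \<omega>))"
    unfolding sq using int by (simp add: Bochner_Integration.integral_sum)
  also have "\<dots> \<le> (\<Sum>v\<in>W. \<Sum>w\<in>W. C\<^sup>2 * of_bool (tree_dist A v w < enat n) + 4 * C\<^sup>2 * ?\<alpha>)"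
    using W by (intro sum_mono product_expectation_le) auto
  also have "\<dots> \<le> (\<Sum>v\<in>W. C\<^sup>2 * real (A + 1) ^ n + 4 * C\<^sup>2 * ?\<alpha> * real (card W))"
    by (intro sum_mono row)
  also have "\<dots> = C\<^sup>2 * real (card W) * real (A + 1) ^ n + 4 * C\<^sup>2 * ?\<alpha> * (real (card W))\<^sup>2"
    by (simp add: algebra_simps power2_eq_square)
  finally show "expectation (\<lambda>\<omega>. (\<Sum>v\<in>W. Z v \<omega>)\<^sup>2) \<le>
      C\<^sup>2 * real (card W) * real (A + 1) ^ n + 4 * C\<^sup>2 * ?\<alpha> * (real (card W))\<^sup>2" .
qed

text \<open>
  The cutoff distance is \<open>2 m\<close> with \<open>m = L div 4\<close>. Close pairs are rare because
  \<open>A + 1 \<le> (3/4) A\<^sup>2\<close> for \<open>A \<ge> 2\<close>, so \<open>(A + 1)\<^sup>2\<^sup>m\<close> is small against \<open>A\<^sup>4\<^sup>m \<le> A\<^sup>L\<close>; distant pairs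
  contribute \<open>\<alpha>(2m)\<close>, in which \<open>(m + 1) / 2\<^sup>m \<le> 2 (3/4)\<^sup>m\<close> removes the linear factor.
\<close>

lemma mean_second_moment_decay:
  assumes rate: "(\<lambda>P. \<Sum>k. alpha_mixing A M Z k * real (pair_count A P k))
                 \<in> O(\<lambda>P. real P * real A ^ P)"
  shows "\<exists>K>0. \<forall>L\<ge>1. expectation (\<lambda>\<omega>. (\<Sum>v\<in>first_generations A L. Z v \<omega>)\<^sup>2)
    \<le> K * (3 / 4) ^ (L div 4) * (real (card (first_generations A L)))\<^sup>2"
proof -
  obtain K where K: "0 < K"
    and \<alpha>: "\<And>m. alpha_mixing A M Z (2 * m) \<le> K * (real m + 1) / real A ^ m"
    using alpha_mixing_decay[OF A rate] by blast
  have "expectation (\<lambda>\<omega>. (\<Sum>v\<in>first_generations A L. Z v \<omega>)\<^sup>2)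
      \<le> (C\<^sup>2 * real A + 8 * C\<^sup>2 * K) * (3 / 4) ^ (L div 4) * (real (card (first_generations A L)))\<^sup>2"
    if L: "1 \<le> L" for L
  proof -
    define m where "m = L div 4"
    define V where "V = first_generations A L"
    define c where "c = real (card V)"
    have ball: "real (A + 1) ^ (2 * m) \<le> real A * (3 / 4) ^ m * c"
    proof -
      \<comment> \<open>The difference of the two sides is \<open>(A - 2) (3 A + 2)\<close>.\<close>
      have "real A * real A * 3 \<ge> 4 * (real A + 1)"
        using A mult_mono[of 0 "real A - 2" 0 "3 * real A + 2"] by (simp add: algebra_simps)
      then have "real (A + 1) ^ (2 * m) \<le> (3 / 4 * (real A)\<^sup>2) ^ (2 * m)"
        by (intro power_mono) (auto simp: power2_eq_square)
      also have "\<dots> = (3 / 4) ^ (2 * m) * real A ^ (4 * m)"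
        by (simp only: power_mult_distrib power_mult[symmetric] mult.assoc[symmetric]) simp
      also have "\<dots> \<le> (3 / 4) ^ m * real A ^ L"
        using A by (intro mult_mono power_decreasing power_increasing) (auto simp: m_def)
      also have "real A ^ L = real A * real A ^ (L - 1)" using L by (cases L) auto
      also have "(3 / 4) ^ m * (real A * real A ^ (L - 1)) \<le> (3 / 4) ^ m * (real A * c)"
        using first_generations_card[OF L, of A] unfolding c_def V_def
        by (intro mult_left_mono) (simp_all flip: of_nat_power)
      finally show ?thesis by (simp add: mult_ac)
    qed
    have mix: "alpha_mixing A M Z (2 * m) \<le> 2 * K * (3 / 4) ^ m"
    proof -
      have "alpha_mixing A M Z (2 * m) \<le> K * (real m + 1) / real A ^ m" by (rule \<alpha>)
      also have "\<dots> \<le> K * (real m + 1) / 2 ^ m"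
        using K A by (intro divide_left_mono power_mono mult_nonneg_nonneg) auto
      also have "\<dots> \<le> K * (2 * (3 / 2) ^ m) / 2 ^ m"
        using K Bernoulli_inequality[of "1 / 2 :: real" m]
        by (intro divide_right_mono mult_left_mono) auto
      also have "(3 / 2 :: real) ^ m / 2 ^ m = (3 / 4) ^ m" by (simp flip: power_divide)
      then have "K * (2 * (3 / 2) ^ m) / 2 ^ m = 2 * K * (3 / 4) ^ m"
        by (metis mult.assoc mult.commute times_divide_eq_right)
      finally show ?thesis .
    qed
    have "expectation (\<lambda>\<omega>. (\<Sum>v\<in>V. Z v \<omega>)\<^sup>2)
        \<le> C\<^sup>2 * c * real (A + 1) ^ (2 * m) + 4 * C\<^sup>2 * alpha_mixing A M Z (2 * m) * c\<^sup>2"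
      unfolding c_def V_def
      by (intro sum_second_moment_le(2) first_generations_finite) (auto simp: first_generations_def)
    also have "\<dots> \<le> C\<^sup>2 * c * (real A * (3 / 4) ^ m * c) + 4 * C\<^sup>2 * (2 * K * (3 / 4) ^ m) * c\<^sup>2"
      using ball mix by (intro add_mono mult_left_mono mult_right_mono) (auto simp: c_def)
    also have "\<dots> = (C\<^sup>2 * real A + 8 * C\<^sup>2 * K) * (3 / 4) ^ m * c\<^sup>2"
      by (simp add: algebra_simps power2_eq_square)
    finally show ?thesis by (simp add: V_def c_def m_def)
  qed
  moreover have "0 < C\<^sup>2 * real A + 8 * C\<^sup>2 * K" using C K by (intro add_nonneg_pos) auto
  ultimately show ?thesis by blast
qed

section \<open>Tail bounds\<close>

lemma mean_tail_decay:
  assumes rate: "(\<lambda>P. \<Sum>k. alpha_mixing A M Z k * real (pair_count A P k))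
                 \<in> O(\<lambda>P. real P * real A ^ P)"
  shows "\<exists>K>0. \<exists>\<delta>>0. \<forall>L\<ge>1. \<forall>\<epsilon>>0.
    prob {\<omega> \<in> space M. 1 / real (card (first_generations A L)) *
        \<bar>\<Sum>v\<in>first_generations A L. Z v \<omega>\<bar> > \<epsilon>} \<le> K * exp (- \<delta> * real L) / \<epsilon>\<^sup>2"
proof -
  obtain K where K: "0 < K" and sm: "\<And>L. 1 \<le> L \<Longrightarrow>
      expectation (\<lambda>\<omega>. (\<Sum>v\<in>first_generations A L. Z v \<omega>)\<^sup>2)
      \<le> K * (3 / 4) ^ (L div 4) * (real (card (first_generations A L)))\<^sup>2"
    using mean_second_moment_decay[OF rate] by blast
  define \<delta> :: real where "\<delta> = ln (4 / 3) / 4"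
  have \<delta>: "0 < \<delta>" by (simp add: \<delta>_def)
  \<comment> \<open>\<open>L div 4\<close> falls short of \<open>L / 4\<close> by at most \<open>3/4\<close>, which costs the factor \<open>exp (3 \<delta>)\<close>.\<close>
  have geo: "(3 / 4) ^ (L div 4) \<le> exp (3 * \<delta>) * exp (- \<delta> * real L)" for L
  proof -
    have "(3 / 4 :: real) = exp (- 4 * \<delta>)" by (simp add: \<delta>_def exp_minus)
    then have "(3 / 4 :: real) ^ (L div 4) = exp (real (L div 4) * (- 4 * \<delta>))"
      by (simp only: exp_of_nat_mult)
    also have "real L \<le> 4 * real (L div 4) + 3" by linarith
    then have "\<delta> * real L \<le> \<delta> * (4 * real (L div 4) + 3)" using \<delta> by (intro mult_left_mono) auto
    then have "exp (real (L div 4) * (- 4 * \<delta>)) \<le> exp (3 * \<delta> + - \<delta> * real L)"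
      by (simp add: algebra_simps)
    finally show ?thesis by (simp only: exp_add)
  qed
  have "prob {\<omega> \<in> space M. 1 / real (card (first_generations A L)) *
        \<bar>\<Sum>v\<in>first_generations A L. Z v \<omega>\<bar> > \<epsilon>} \<le> K * exp (3 * \<delta>) * exp (- \<delta> * real L) / \<epsilon>\<^sup>2"
    if L: "1 \<le> L" and \<epsilon>: "0 < \<epsilon>" for L \<epsilon>
  proof -
    define V where "V = first_generations A L"
    define c where "c = real (card V)"
    have V: "finite V" "V \<subseteq> tree_nodes A"
      using first_generations_finite by (auto simp: V_def first_generations_def)
    have "1 \<le> A ^ (L - 1)" using A by simp
    then have c: "0 < c" using first_generations_card[OF L, of A] unfolding c_def V_def by linarith
    have S[measurable]: "(\<lambda>\<omega>. \<Sum>v\<in>V. Z v \<omega>) \<in> borel_measurable M"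
      using V meas by (intro borel_measurable_sum) auto
    have "prob {\<omega> \<in> space M. 1 / c * \<bar>\<Sum>v\<in>V. Z v \<omega>\<bar> > \<epsilon>}
        \<le> prob {\<omega> \<in> space M. \<bar>\<Sum>v\<in>V. Z v \<omega>\<bar> \<ge> \<epsilon> * c}"
      using c by (intro finite_measure_mono) (auto simp: field_simps)
    also have "\<dots> \<le> expectation (\<lambda>\<omega>. (\<Sum>v\<in>V. Z v \<omega>)\<^sup>2) / (\<epsilon> * c)\<^sup>2"
      using c \<epsilon> sum_second_moment_le(1)[OF V] by (intro second_moment_method S) auto
    also have "\<dots> \<le> K * (3 / 4) ^ (L div 4) * c\<^sup>2 / (\<epsilon> * c)\<^sup>2"
      using sm[OF L] unfolding V_def c_def by (intro divide_right_mono) auto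
    also have "\<dots> = K * (3 / 4) ^ (L div 4) / \<epsilon>\<^sup>2"
      using c by (simp add: power_mult_distrib)
    also have "\<dots> \<le> K * (exp (3 * \<delta>) * exp (- \<delta> * real L)) / \<epsilon>\<^sup>2"
      using K by (intro divide_right_mono mult_left_mono geo) auto
    finally show ?thesis by (simp add: V_def c_def mult.assoc)
  qed
  then show ?thesis using K \<delta> by (intro exI[of _ "K * exp (3 * \<delta>)"] exI[of _ \<delta>] conjI) auto
qed

lemma mean_le_bound_AE:
  "AE \<omega> in M. 1 / real (card (first_generations A L)) * \<bar>\<Sum>v\<in>first_generations A L. Z v \<omega>\<bar> \<le> C"
proof -
  have "AE \<omega> in M. \<forall>v\<in>first_generations A L. \<bar>Z v \<omega>\<bar> \<le> C"
    using first_generations_finite bound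
    by (intro AE_finite_allI) (auto simp: first_generations_def)
  then show ?thesis
  proof eventually_elim
    case (elim \<omega>)
    have "\<bar>\<Sum>v\<in>first_generations A L. Z v \<omega>\<bar> \<le> (\<Sum>v\<in>first_generations A L. \<bar>Z v \<omega>\<bar>)"
      by (rule sum_abs)
    also have "\<dots> \<le> real (card (first_generations A L)) * C"
      using elim by (intro sum_bounded_above) auto
    finally show ?case using C by (cases "card (first_generations A L) = 0") (auto simp: field_simps)
  qed
qed

end

text \<open>
  Here \<open>p\<close> is the tail probability and \<open>x = L\<close>. For small \<open>\<epsilon>\<close> the factor \<open>exp c2\<close> makes the bound
  trivial. For \<open>ln x / x < \<epsilon> \<le> C\<close> half of the exponent \<open>\<delta> x\<close> absorbs the polynomial factor
  \<open>1 / \<epsilon>\<^sup>2 \<le> (x / ln 2)\<^sup>2\<close>, and \<open>c2\<close> is chosen such that \<open>c2 \<epsilon> x / ln x\<close> is at most the other half.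
\<close>

lemma exponential_bound_from_chebyshev:
  fixes p K \<delta> C \<epsilon> x :: real
  assumes p: "p \<le> 1" "p \<le> K * exp (- \<delta> * x) / \<epsilon>\<^sup>2" "C < \<epsilon> \<Longrightarrow> p \<le> 0"
    and pos: "0 < K" "0 < \<delta>" "0 < C" "0 < \<epsilon>" and x: "2 \<le> x"
    and c2: "c2 = \<delta> * ln 2 / (2 * C)"
  shows "p \<le> (exp c2 + 16 * K / (\<delta> * ln 2)\<^sup>2) * exp (- c2 * \<epsilon> * (x / ln x))"
proof -
  let ?c = "16 * K / (\<delta> * ln 2)\<^sup>2" and ?e = "exp (- c2 * \<epsilon> * (x / ln x))"
  have lnx: "0 < ln (2::real)" "ln 2 \<le> ln x" "0 < ln x" using x by auto
  have c2pos: "0 < c2" using pos lnx by (simp add: c2)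
  have c: "0 \<le> ?c" using pos by simp
  consider "C < \<epsilon>" | "\<epsilon> \<le> ln x / x" | "\<epsilon> \<le> C" "ln x / x < \<epsilon>" by linarith
  then show ?thesis
  proof cases
    case 1
    then have "p \<le> 0" by (rule p)
    also have "0 \<le> (exp c2 + ?c) * ?e" using c by (intro mult_nonneg_nonneg add_nonneg_nonneg) auto
    finally show ?thesis .
  next
    case 2
    then have "\<epsilon> * (x / ln x) \<le> 1" using lnx x by (simp add: field_simps)
    then have "c2 * (\<epsilon> * (x / ln x)) \<le> c2 * 1" using c2pos by (intro mult_left_mono) auto
    then have "1 \<le> exp (c2 + - c2 * \<epsilon> * (x / ln x))" by (simp add: mult.assoc)
    also have "\<dots> = exp c2 * ?e" by (rule exp_add)
    also have "\<dots> \<le> (exp c2 + ?c) * ?e" using c by (intro mult_right_mono) auto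
    finally show ?thesis using p by linarith
  next
    case 3
    have "ln x < \<epsilon> * x" using 3(2) x by (simp add: divide_less_eq)
    then have "ln 2 \<le> \<epsilon> * x" using lnx(2) by linarith
    then have "(ln 2)\<^sup>2 \<le> (\<epsilon> * x)\<^sup>2" using lnx by (intro power_mono) auto
    then have e: "1 / \<epsilon>\<^sup>2 \<le> x\<^sup>2 / (ln 2)\<^sup>2" using pos lnx by (simp add: field_simps power_mult_distrib)
    \<comment> \<open>The constant 16 comes from squaring \<open>\<delta> x / 4 \<le> exp (\<delta> x / 4)\<close>.\<close>
    have "\<delta> * x / 4 \<le> exp (\<delta> * x / 4)" using exp_ge_add_one_self[of "\<delta> * x / 4"] by linarith
    then have "(\<delta> * x / 4)\<^sup>2 \<le> (exp (\<delta> * x / 4))\<^sup>2" using pos x by (intro power_mono) auto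
    also have "\<dots> = exp (\<delta> * x / 2)" by (simp flip: exp_double)
    finally have q: "x\<^sup>2 \<le> 16 / \<delta>\<^sup>2 * exp (\<delta> * x / 2)" using pos by (simp add: field_simps power_mult_distrib)
    have "p \<le> K * exp (- \<delta> * x) * (1 / \<epsilon>\<^sup>2)" using p by simp
    also have "\<dots> \<le> K * exp (- \<delta> * x) * (x\<^sup>2 / (ln 2)\<^sup>2)" using e pos by (intro mult_left_mono) auto
    also have "\<dots> \<le> K * exp (- \<delta> * x) * (16 / \<delta>\<^sup>2 * exp (\<delta> * x / 2) / (ln 2)\<^sup>2)"
      using q pos by (intro mult_left_mono divide_right_mono) auto
    also have "\<dots> = ?c * (exp (- \<delta> * x) * exp (\<delta> * x / 2))" by (simp add: power_mult_distrib)
    also have "exp (- \<delta> * x) * exp (\<delta> * x / 2) = exp (- \<delta> * x / 2)" by (simp flip: exp_add)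
    also have "?c * exp (- \<delta> * x / 2) \<le> ?c * ?e"
    proof -
      have "c2 * \<epsilon> * (x / ln x) \<le> c2 * C * (x / ln 2)"
        using 3(1) c2pos lnx x pos by (intro mult_mono divide_left_mono mult_left_mono) auto
      also have "\<dots> = \<delta> * x / 2" using pos lnx by (simp add: c2)
      finally show ?thesis using c by (intro mult_left_mono) auto
    qed
    also have "\<dots> \<le> (exp c2 + ?c) * ?e" by (intro mult_right_mono) auto
    finally show ?thesis .
  qed
qed

theorem theorem2p3:
  fixes A :: nat
    and M :: "'a measure"
    and Z :: "nat \<times> nat \<Rightarrow> 'a \<Rightarrow> real"
    and \<sigma> C :: real
  assumes A: "2 \<le> A"
    and M: "prob_space M"
    and pos: "0 < \<sigma>" "0 < C"
    and meas: "\<And>v. v \<in> tree_nodes A \<Longrightarrow> Z v \<in> borel_measurable M"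
    and mean: "\<And>v. v \<in> tree_nodes A \<Longrightarrow> prob_space.expectation M (Z v) = 0"
    and bdd: "\<And>v. v \<in> tree_nodes A \<Longrightarrow> esssup M (\<lambda>\<omega>. ereal \<bar>Z v \<omega>\<bar>) \<le> ereal C"
    and var: "\<And>v. v \<in> tree_nodes A \<Longrightarrow> prob_space.variance M (Z v) \<le> \<sigma>\<^sup>2"
    and mixing: "alpha_mixing A M Z \<longlonglongrightarrow> 0"
    and rate: "(\<lambda>P. \<Sum>k. alpha_mixing A M Z k * real (pair_count A P k))
                 \<in> O(\<lambda>P. real P * real A ^ P)"
  shows "\<exists>c1 c2 :: real. 0 < c1 \<and> 0 < c2 \<and>
    (\<forall>L :: nat. \<forall>\<epsilon> :: real. 2 \<le> L \<longrightarrow> 0 < \<epsilon> \<longrightarrow>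
      measure M {\<omega> \<in> space M.
          1 / real (card (first_generations A L)) *
            \<bar>\<Sum>v\<in>first_generations A L. Z v \<omega>\<bar> > \<epsilon>}
        \<le> c1 * exp (- c2 * \<epsilon> * (real L / ln (real L))))"
proof -
  interpret prob_space M by (rule M)
  have bound: "AE \<omega> in M. \<bar>Z v \<omega>\<bar> \<le> C" if "v \<in> tree_nodes A" for v
    using esssup_AE[of "\<lambda>\<omega>. ereal \<bar>Z v \<omega>\<bar>" M]
  proof eventually_elim
    case (elim \<omega>)
    then have "ereal \<bar>Z v \<omega>\<bar> \<le> ereal C" using bdd[OF that] by (rule order_trans)
    then show ?case by simp
  qed
  interpret tree_field M A Z C
    by unfold_locales (use A pos meas mean bound in auto)
  obtain K \<delta> where K: "0 < K" and \<delta>: "0 < \<delta>" and tail: "\<And>L \<epsilon>. 1 \<le> L \<Longrightarrow> 0 < \<epsilon> \<Longrightarrow>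
      prob {\<omega> \<in> space M. 1 / real (card (first_generations A L)) *
        \<bar>\<Sum>v\<in>first_generations A L. Z v \<omega>\<bar> > \<epsilon>} \<le> K * exp (- \<delta> * real L) / \<epsilon>\<^sup>2"
    using mean_tail_decay[OF rate] by blast
  define c2 where "c2 = \<delta> * ln 2 / (2 * C)"
  define c1 where "c1 = exp c2 + 16 * K / (\<delta> * ln 2)\<^sup>2"
  have "0 < c2" using \<delta> pos by (simp add: c2_def)
  moreover have "0 < c1" unfolding c1_def using K by (intro add_pos_nonneg) auto
  moreover have "prob {\<omega> \<in> space M. 1 / real (card (first_generations A L)) *
        \<bar>\<Sum>v\<in>first_generations A L. Z v \<omega>\<bar> > \<epsilon>} \<le> c1 * exp (- c2 * \<epsilon> * (real L / ln (real L)))"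
    (is "prob ?E \<le> _") if L: "2 \<le> L" and \<epsilon>: "0 < \<epsilon>" for L \<epsilon>
    unfolding c1_def
  proof (rule exponential_bound_from_chebyshev)
    show "prob ?E \<le> K * exp (- \<delta> * real L) / \<epsilon>\<^sup>2" using L \<epsilon> by (intro tail) auto
    assume "C < \<epsilon>"
    have "(\<lambda>\<omega>. \<Sum>v\<in>first_generations A L. Z v \<omega>) \<in> borel_measurable M"
      using meas by (intro borel_measurable_sum) (auto simp: first_generations_def)
    then have "?E \<in> events" by measurable
    moreover have "AE \<omega> in M. \<not> 1 / real (card (first_generations A L)) *
        \<bar>\<Sum>v\<in>first_generations A L. Z v \<omega>\<bar> > \<epsilon>"
      using mean_le_bound_AE[of L] by eventually_elim (use \<open>C < \<epsilon>\<close> in linarith)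
    ultimately have "prob ?E = 0" by (simp add: prob_Collect_eq_0)
    then show "prob ?E \<le> 0" by simp
  qed (use K \<delta> pos L \<epsilon> c2_def in auto)
  ultimately show ?thesis by blast
qed

end
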